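(* Let $\lambda\in\mathbb C$. The $\mathfrak{sl}(2)$-module $\bar M(\lambda+2)$ admits exactly one compatible structure of $\mathbf{Witt}_{<}$-module; namely, for $i\le1$ and $j\ge0$, $$\rho(L_i)w_j=\Big(-\tfrac12\big(2(1+j)+(1-i)\lambda\big)\,P(j+i+1,-i)\Big)w_{j+i},$$ where the right-hand side is $0$ if $j+i<0$.
   Context: $\mathfrak{sl}(2)=\mathfrak{sl}(2,\mathbb C)$ has Chevalley basis $\{e,f,h\}$ with $[e,f]=h$, $[h,e]=2e$, $[h,f]=-2f$. $\mathbf{Witt}_{<}$ is the complex Lie algebra with basis $\{L_k\}_{k\le1}$ and bracket $[L_i,L_j]=(i-j)L_{i+j}$; $\mathfrak{sl}(2)$ is embedded in it by $f\mapsto L_{-1}$, $h\mapsto-2L_0$, $e\mapsto-L_1$, and a $\mathbf{Witt}_{<}$-module structure on an $\mathfrak{sl}(2)$-module is compatible if its restriction along this embedding is the given $\mathfrak{sl}(2)$-structure. For $\nu\in\mathbb C$, $\bar M(\nu)$ is the vector space with basis $\{w_j:j=0,1,2,\dots\}$ and action $e w_j=w_{j+1}$, $h w_j=(\nu+2j)w_j$, $f w_j=-j(\nu+j-1)w_{j-1}$ for $j\ne0$, $f w_0=0$. The Pochhammer symbol is $P(z,n)=z(z+1)\cdots(z+n-1)$ for $n\ge0$ and $P(z,n)=\frac1{(z+n)(z+n+1)\cdots(z-1)}$ for $n\le-1$. *)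

theory Defs
  imports Complex_Main "HOL-Library.Poly_Mapping" "HOL-Library.FuncSet"
begin

text \<open>The Lie algebra is a subspace \<open>g\<close> of an ambient vector space, so that
  \<open>Witt\<^sub><\<close> below can be taken inside the Lie algebra spanned by all \<open>L\<^sub>k\<close>, \<open>k \<in> \<int>\<close>.\<close>

locale lie_algebra = vector_space scale
  for scale :: "complex \<Rightarrow> 'g::ab_group_add \<Rightarrow> 'g" (infixr \<open>*\<^sub>g\<close> 75) +
  fixes g :: "'g set" and bracket :: "'g \<Rightarrow> 'g \<Rightarrow> 'g"
  assumes subspace_carrier: "subspace g"
    and bracket_closed: "x \<in> g \<Longrightarrow> y \<in> g \<Longrightarrow> bracket x y \<in> g"
    and bracket_add_left: "x \<in> g \<Longrightarrow> y \<in> g \<Longrightarrow> z \<in> g \<Longrightarrow> bracket (x + y) z = bracket x z + bracket y z"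
    and bracket_add_right: "x \<in> g \<Longrightarrow> y \<in> g \<Longrightarrow> z \<in> g \<Longrightarrow> bracket x (y + z) = bracket x y + bracket x z"
    and bracket_scale_left: "x \<in> g \<Longrightarrow> y \<in> g \<Longrightarrow> bracket (c *\<^sub>g x) y = c *\<^sub>g bracket x y"
    and bracket_scale_right: "x \<in> g \<Longrightarrow> y \<in> g \<Longrightarrow> bracket x (c *\<^sub>g y) = c *\<^sub>g bracket x y"
    and bracket_self: "x \<in> g \<Longrightarrow> bracket x x = 0"
    and jacobi: "x \<in> g \<Longrightarrow> y \<in> g \<Longrightarrow> z \<in> g \<Longrightarrow>
      bracket x (bracket y z) + bracket y (bracket z x) + bracket z (bracket x y) = 0"

locale lie_module = lie_algebra scale g bracket + V: vector_space scaleV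
  for scale :: "complex \<Rightarrow> 'g::ab_group_add \<Rightarrow> 'g" (infixr \<open>*\<^sub>g\<close> 75)
    and g :: "'g set" and bracket :: "'g \<Rightarrow> 'g \<Rightarrow> 'g"
    and scaleV :: "complex \<Rightarrow> 'v::ab_group_add \<Rightarrow> 'v" (infixr \<open>*\<^sub>v\<close> 75) +
  fixes \<rho> :: "'g \<Rightarrow> 'v \<Rightarrow> 'v"
  assumes linear_act: "x \<in> g \<Longrightarrow> Vector_Spaces.linear scaleV scaleV (\<rho> x)"
    and act_add: "x \<in> g \<Longrightarrow> y \<in> g \<Longrightarrow> \<rho> (x + y) v = \<rho> x v + \<rho> y v"
    and act_scale: "x \<in> g \<Longrightarrow> \<rho> (c *\<^sub>g x) v = c *\<^sub>v \<rho> x v"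
    and act_bracket: "x \<in> g \<Longrightarrow> y \<in> g \<Longrightarrow> \<rho> (bracket x y) v = \<rho> x (\<rho> y v) - \<rho> y (\<rho> x v)"

text \<open>The complex vector space with basis indexed by \<open>'b\<close> is the space
  \<open>'b \<Rightarrow>\<^sub>0 complex\<close> of finitely supported coefficient functions.\<close>

definition fscale :: "complex \<Rightarrow> ('b \<Rightarrow>\<^sub>0 complex) \<Rightarrow> ('b \<Rightarrow>\<^sub>0 complex)" (infixr \<open>\<odot>\<close> 75)
  where "c \<odot> x = Poly_Mapping.map ((*) c) x"

definition bvec :: "'b \<Rightarrow> ('b \<Rightarrow>\<^sub>0 complex)"
  where "bvec b = Poly_Mapping.single b 1"

definition lin_ext :: "('b \<Rightarrow> ('c \<Rightarrow>\<^sub>0 complex)) \<Rightarrow> ('b \<Rightarrow>\<^sub>0 complex) \<Rightarrow> ('c \<Rightarrow>\<^sub>0 complex)"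
  where "lin_ext \<phi> x = (\<Sum>b\<in>Poly_Mapping.keys x. Poly_Mapping.lookup x b \<odot> \<phi> b)"

definition bilin_ext :: "('a \<Rightarrow> 'b \<Rightarrow> ('c \<Rightarrow>\<^sub>0 complex)) \<Rightarrow> ('a \<Rightarrow>\<^sub>0 complex) \<Rightarrow> ('b \<Rightarrow>\<^sub>0 complex) \<Rightarrow> ('c \<Rightarrow>\<^sub>0 complex)"
  where "bilin_ext \<phi> x y = lin_ext (\<lambda>a. lin_ext (\<phi> a) y) x"

lemma lookup_fscale [simp]: "Poly_Mapping.lookup (c \<odot> x) b = c * Poly_Mapping.lookup x b"
  by (simp add: fscale_def Poly_Mapping.map.rep_eq when_def)

lemma vector_space_fscale: "vector_space fscale"
  by unfold_locales (auto intro!: poly_mapping_eqI simp: lookup_add algebra_simps)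

interpretation fs: vector_space fscale
  by (rule vector_space_fscale)

lemma lin_ext_superset:
  assumes "finite A" "Poly_Mapping.keys x \<subseteq> A"
  shows "lin_ext \<phi> x = (\<Sum>b\<in>A. Poly_Mapping.lookup x b \<odot> \<phi> b)"
  unfolding lin_ext_def using assms
  by (intro sum.mono_neutral_left) (auto simp: in_keys_iff)

lemma lin_ext_add: "lin_ext \<phi> (x + y) = lin_ext \<phi> x + lin_ext \<phi> y"
proof -
  let ?A = "Poly_Mapping.keys x \<union> Poly_Mapping.keys y"
  have "lin_ext \<phi> z = (\<Sum>b\<in>?A. Poly_Mapping.lookup z b \<odot> \<phi> b)" if "z \<in> {x, y, x + y}" for z
    using that Poly_Mapping.keys_add[of x y] by (intro lin_ext_superset) auto
  then show ?thesis
    by (simp add: lookup_add fs.scale_left_distrib sum.distrib)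
qed

lemma lin_ext_scale: "lin_ext \<phi> (c \<odot> x) = c \<odot> lin_ext \<phi> x"
proof -
  have "lin_ext \<phi> (c \<odot> x) = (\<Sum>b\<in>Poly_Mapping.keys x. Poly_Mapping.lookup (c \<odot> x) b \<odot> \<phi> b)"
    by (intro lin_ext_superset) (auto simp: in_keys_iff)
  then show ?thesis
    by (simp add: lin_ext_def fs.scale_sum_right)
qed

lemma linear_lin_ext: "Vector_Spaces.linear fscale fscale (lin_ext \<phi>)"
  by (simp add: Vector_Spaces.linear_iff vector_space_fscale lin_ext_add lin_ext_scale)

lemma lin_ext_bvec [simp]: "lin_ext \<phi> (bvec b) = \<phi> b"
  by (simp add: lin_ext_def bvec_def)

lemma lin_ext_zero [simp]: "lin_ext \<phi> 0 = 0"
  by (simp add: lin_ext_def)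

lemma lin_ext_fun_add: "lin_ext (\<lambda>a. \<phi> a + \<psi> a) x = lin_ext \<phi> x + lin_ext \<psi> x"
  by (simp add: lin_ext_def fs.scale_right_distrib sum.distrib)

lemma lin_ext_fun_scale: "lin_ext (\<lambda>a. c \<odot> \<phi> a) x = c \<odot> lin_ext \<phi> x"
  by (simp add: lin_ext_def fs.scale_sum_right mult.commute)

lemma lin_ext_fun_zero [simp]: "lin_ext (\<lambda>a. 0) x = 0"
  by (simp add: lin_ext_def)

lemma bilin_ext_simps:
  "bilin_ext \<phi> (x + x') y = bilin_ext \<phi> x y + bilin_ext \<phi> x' y"
  "bilin_ext \<phi> x (y + y') = bilin_ext \<phi> x y + bilin_ext \<phi> x y'"
  "bilin_ext \<phi> (c \<odot> x) y = c \<odot> bilin_ext \<phi> x y"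
  "bilin_ext \<phi> x (c \<odot> y) = c \<odot> bilin_ext \<phi> x y"
  "bilin_ext \<phi> 0 y = 0" "bilin_ext \<phi> x 0 = 0"
  "bilin_ext \<phi> (bvec a) (bvec b) = \<phi> a b"
  by (simp_all add: bilin_ext_def lin_ext_add lin_ext_scale lin_ext_fun_add lin_ext_fun_scale)

lemma linear_bilin_ext: "Vector_Spaces.linear fscale fscale (bilin_ext \<phi> x)"
  by (simp add: Vector_Spaces.linear_iff vector_space_fscale bilin_ext_simps)

lemma span_bvec: "fs.span (range bvec) = UNIV"
proof -
  have "x \<in> fs.span (range bvec)" for x :: "'a \<Rightarrow>\<^sub>0 complex"
  proof -
    have "x = (\<Sum>b\<in>Poly_Mapping.keys x. Poly_Mapping.lookup x b \<odot> bvec b)"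
      by (rule poly_mapping_eqI)
        (auto simp: lookup_sum bvec_def lookup_single when_def in_keys_iff if_distrib cong: if_cong)
    also have "\<dots> \<in> fs.span (range bvec)"
      by (intro fs.span_sum fs.span_scale fs.span_base) auto
    finally show ?thesis .
  qed
  then show ?thesis by auto
qed

lemma bvec_induct [case_names zero step]:
  assumes "P 0" and "\<And>c b x. P x \<Longrightarrow> P (c \<odot> bvec b + x)"
  shows "P x"
proof -
  have "x \<in> fs.span (range bvec)" by (simp add: span_bvec)
  then show ?thesis
    by (induction rule: fs.span_induct_alt) (use assms in auto)
qed

lemma bilin_ext_jacobi:
  fixes \<phi> :: "'a \<Rightarrow> 'a \<Rightarrow> ('a \<Rightarrow>\<^sub>0 complex)"
  assumes "\<And>a b c. bilin_ext \<phi> (bvec a) (\<phi> b c) + bilin_ext \<phi> (bvec b) (\<phi> c a) + bilin_ext \<phi> (bvec c) (\<phi> a b) = 0"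
  shows "bilin_ext \<phi> x (bilin_ext \<phi> y z) + bilin_ext \<phi> y (bilin_ext \<phi> z x) + bilin_ext \<phi> z (bilin_ext \<phi> x y) = 0"
    (is "?J x y z = 0")
proof -
  have 1: "?J (bvec a) (bvec b) z = 0" for a b
  proof (induction z rule: bvec_induct)
    case (step c d z)
    have "?J (bvec a) (bvec b) (c \<odot> bvec d + z) = c \<odot> ?J (bvec a) (bvec b) (bvec d) + ?J (bvec a) (bvec b) z"
      by (simp add: bilin_ext_simps fs.scale_right_distrib algebra_simps)
    with step show ?case by (simp add: assms bilin_ext_simps)
  qed (simp add: bilin_ext_simps)
  have 2: "?J (bvec a) y z = 0" for a
  proof (induction y rule: bvec_induct)
    case (step c d y)
    have "?J (bvec a) (c \<odot> bvec d + y) z = c \<odot> ?J (bvec a) (bvec d) z + ?J (bvec a) y z"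
      by (simp add: bilin_ext_simps fs.scale_right_distrib algebra_simps)
    with step 1 show ?case by simp
  qed (simp add: bilin_ext_simps)
  show ?thesis
  proof (induction x rule: bvec_induct)
    case (step c d x)
    have "?J (c \<odot> bvec d + x) y z = c \<odot> ?J (bvec d) y z + ?J x y z"
      by (simp add: bilin_ext_simps fs.scale_right_distrib algebra_simps)
    with step 2 show ?case by simp
  qed (simp add: bilin_ext_simps)
qed

lemma bilin_ext_skew:
  fixes \<phi> :: "'a \<Rightarrow> 'a \<Rightarrow> ('a \<Rightarrow>\<^sub>0 complex)"
  assumes "\<And>a b. \<phi> a b = - \<phi> b a"
  shows "bilin_ext \<phi> x y = - bilin_ext \<phi> y x"
proof -
  have 1: "bilin_ext \<phi> (bvec a) y = - bilin_ext \<phi> y (bvec a)" for a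
  proof (induction y rule: bvec_induct)
    case (step c d y)
    then show ?case using assms[of a d] by (simp add: bilin_ext_simps)
  qed (simp add: bilin_ext_simps)
  show ?thesis
  proof (induction x rule: bvec_induct)
    case (step c d x)
    then show ?case using 1[of d] by (simp add: bilin_ext_simps)
  qed (simp add: bilin_ext_simps)
qed

lemma lie_algebra_bilin_ext:
  assumes "fs.subspace g" "\<And>x y. x \<in> g \<Longrightarrow> y \<in> g \<Longrightarrow> bilin_ext \<phi> x y \<in> g"
    and skew: "\<And>a b. \<phi> a b = - \<phi> b a"
    and "\<And>a b c. bilin_ext \<phi> (bvec a) (\<phi> b c) + bilin_ext \<phi> (bvec b) (\<phi> c a) + bilin_ext \<phi> (bvec c) (\<phi> a b) = 0"
  shows "lie_algebra fscale g (bilin_ext \<phi>)"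
proof
  fix x
  have "2 \<odot> bilin_ext \<phi> x x = bilin_ext \<phi> x x + bilin_ext \<phi> x x"
    by (rule poly_mapping_eqI) (simp add: lookup_add)
  also have "\<dots> = 0"
    using bilin_ext_skew[of \<phi> x x, OF skew] by (metis add.right_inverse)
  finally show "bilin_ext \<phi> x x = 0" by simp
qed (use assms(1,2,4) in \<open>simp_all add: bilin_ext_simps bilin_ext_jacobi\<close>)

datatype sl2_index = Sl2_e | Sl2_f | Sl2_h

type_synonym sl2 = "sl2_index \<Rightarrow>\<^sub>0 complex"

fun sl2_structure :: "sl2_index \<Rightarrow> sl2_index \<Rightarrow> sl2" where
  "sl2_structure Sl2_e Sl2_f = bvec Sl2_h"
| "sl2_structure Sl2_f Sl2_e = - bvec Sl2_h"
| "sl2_structure Sl2_h Sl2_e = 2 \<odot> bvec Sl2_e"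
| "sl2_structure Sl2_e Sl2_h = - (2 \<odot> bvec Sl2_e)"
| "sl2_structure Sl2_h Sl2_f = - (2 \<odot> bvec Sl2_f)"
| "sl2_structure Sl2_f Sl2_h = 2 \<odot> bvec Sl2_f"
| "sl2_structure Sl2_e Sl2_e = 0"
| "sl2_structure Sl2_f Sl2_f = 0"
| "sl2_structure Sl2_h Sl2_h = 0"

definition sl2_bracket :: "sl2 \<Rightarrow> sl2 \<Rightarrow> sl2"
  where "sl2_bracket = bilin_ext sl2_structure"

type_synonym witt = "int \<Rightarrow>\<^sub>0 complex"

abbreviation L :: "int \<Rightarrow> witt"
  where "L k \<equiv> bvec k"

definition witt_bracket :: "witt \<Rightarrow> witt \<Rightarrow> witt"
  where "witt_bracket = bilin_ext (\<lambda>i j. of_int (i - j) \<odot> L (i + j))"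

definition witt_lt :: "witt set"
  where "witt_lt = fs.span {L k | k. k \<le> 1}"

definition sl2_embed :: "sl2 \<Rightarrow> witt"
  where "sl2_embed = lin_ext (\<lambda>a. case a of
    Sl2_f \<Rightarrow> L (-1) | Sl2_h \<Rightarrow> - (2 \<odot> L 0) | Sl2_e \<Rightarrow> - L 1)"

lemma bilin_ext_uminus:
  "bilin_ext \<phi> (- x) y = - bilin_ext \<phi> x y" "bilin_ext \<phi> x (- y) = - bilin_ext \<phi> x y"
  using bilin_ext_simps(3)[of \<phi> "-1" x y] bilin_ext_simps(4)[of \<phi> x "-1" y] by simp_all

lemma lie_algebra_sl2: "lie_algebra fscale UNIV sl2_bracket"
  unfolding sl2_bracket_def
proof (rule lie_algebra_bilin_ext)
  show "sl2_structure a b = - sl2_structure b a" for a b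
    by (cases a; cases b) auto
  show "bilin_ext sl2_structure (bvec a) (sl2_structure b c) + bilin_ext sl2_structure (bvec b) (sl2_structure c a)
      + bilin_ext sl2_structure (bvec c) (sl2_structure a b) = 0" for a b c
    by (cases a; cases b; cases c) (simp_all add: bilin_ext_simps bilin_ext_uminus)
qed auto

lemma lie_algebra_witt_lt: "lie_algebra fscale witt_lt witt_bracket"
  unfolding witt_bracket_def
proof (rule lie_algebra_bilin_ext)
  let ?\<phi> = "\<lambda>i j::int. (of_int (i - j) :: complex) \<odot> L (i + j)"
  show "fs.subspace witt_lt" by (simp add: witt_lt_def)
  show "?\<phi> a b = - ?\<phi> b a" for a b
    by (simp add: add.commute fs.scale_minus_left [symmetric])
  show "bilin_ext ?\<phi> (bvec a) (?\<phi> b c) + bilin_ext ?\<phi> (bvec b) (?\<phi> c a) + bilin_ext ?\<phi> (bvec c) (?\<phi> a b) = 0" for a b c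
  proof (rule poly_mapping_eqI)
    fix k
    have "(of_int (b - c) * of_int (a - (b + c)) + of_int (c - a) * of_int (b - (c + a))
        + of_int (a - b) * of_int (c - (a + b)) :: complex) * Poly_Mapping.lookup (L (a + b + c)) k = 0"
      by (simp add: algebra_simps)
    then show "Poly_Mapping.lookup (bilin_ext ?\<phi> (bvec a) (?\<phi> b c) + bilin_ext ?\<phi> (bvec b) (?\<phi> c a)
        + bilin_ext ?\<phi> (bvec c) (?\<phi> a b)) k = Poly_Mapping.lookup 0 k"
      by (simp only: bilin_ext_simps lookup_add lookup_fscale lookup_zero distrib_right mult.assoc add_ac)
  qed
  have base: "?\<phi> a b \<in> witt_lt" if "a \<le> 1" "b \<le> 1" for a b
  proof (cases "a = 1 \<and> b = 1")
    case False
    with that have "a + b \<le> 1" by linarith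
    then show ?thesis
      unfolding witt_lt_def by (intro fs.span_scale fs.span_base) blast
  qed (simp add: witt_lt_def fs.span_zero)
  have 1: "bilin_ext ?\<phi> (bvec a) y \<in> witt_lt" if "a \<le> 1" "y \<in> witt_lt" for a y
    using that(2)[unfolded witt_lt_def]
  proof (induction rule: fs.span_induct_alt)
    case (step c x y)
    then show ?case using base[OF that(1)]
      by (auto simp: bilin_ext_simps witt_lt_def simp del: of_int_diff intro!: fs.span_add fs.span_scale)
  qed (simp add: bilin_ext_simps witt_lt_def fs.span_zero)
  show "bilin_ext ?\<phi> x y \<in> witt_lt" if "x \<in> witt_lt" "y \<in> witt_lt" for x y
    using that(1)[unfolded witt_lt_def]
  proof (induction rule: fs.span_induct_alt)
    case (step c x z)
    then show ?case using 1[OF _ that(2)]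
      by (auto simp: bilin_ext_simps witt_lt_def simp del: of_int_diff intro!: fs.span_add fs.span_scale)
  qed (simp add: bilin_ext_simps witt_lt_def fs.span_zero)
qed

lemma sl2_embed_in_witt_lt: "sl2_embed x \<in> witt_lt"
proof (induction x rule: bvec_induct)
  case (step c b x)
  have "L k \<in> fs.span {L k | k. k \<le> 1}" if "k \<le> 1" for k
    using that by (intro fs.span_base) blast
  then have "sl2_embed (bvec b) \<in> witt_lt"
    unfolding sl2_embed_def witt_lt_def
    by (cases b) (auto intro!: fs.span_neg[of "L 1"] fs.span_neg[of "2 \<odot> L 0"] fs.span_scale)
  with step show ?case
    by (auto simp: sl2_embed_def lin_ext_add lin_ext_scale witt_lt_def intro!: fs.span_add fs.span_scale)
qed (simp add: sl2_embed_def witt_lt_def fs.span_zero)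

lemma sl2_embed_bracket: "sl2_embed (sl2_bracket x y) = witt_bracket (sl2_embed x) (sl2_embed y)"
proof -
  note simps = sl2_embed_def sl2_bracket_def witt_bracket_def bilin_ext_simps lin_ext_add lin_ext_scale
  have neg: "lin_ext \<phi> (- x) = - lin_ext \<phi> x" for \<phi> :: "sl2_index \<Rightarrow> witt" and x
    using lin_ext_scale[of \<phi> "-1" x] by simp
  have 0: "sl2_embed (sl2_bracket (bvec a) (bvec b)) = witt_bracket (sl2_embed (bvec a)) (sl2_embed (bvec b))" for a b
    by (cases a; cases b) (simp_all add: simps neg bilin_ext_uminus)
  have 1: "sl2_embed (sl2_bracket (bvec a) y) = witt_bracket (sl2_embed (bvec a)) (sl2_embed y)" for a
  proof (induction y rule: bvec_induct)
    case (step c b y)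
    then show ?case using 0[of a b] by (simp add: simps)
  qed (simp add: simps)
  show ?thesis
  proof (induction x rule: bvec_induct)
    case (step c b x)
    then show ?case using 1[of b] by (simp add: simps)
  qed (simp add: simps)
qed

text \<open>The basis vector \<open>w\<^sub>j\<close> is \<open>bvec j\<close> in \<open>nat \<Rightarrow>\<^sub>0 complex\<close>.\<close>

type_synonym mbar = "nat \<Rightarrow>\<^sub>0 complex"

abbreviation w :: "nat \<Rightarrow> mbar"
  where "w j \<equiv> bvec j"

fun mbar_basis_act :: "complex \<Rightarrow> sl2_index \<Rightarrow> nat \<Rightarrow> mbar" where
  "mbar_basis_act \<nu> Sl2_e j = w (j + 1)"
| "mbar_basis_act \<nu> Sl2_h j = (\<nu> + 2 * of_nat j) \<odot> w j"
| "mbar_basis_act \<nu> Sl2_f j =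
    (if j = 0 then 0 else (- of_nat j * (\<nu> + of_nat j - 1)) \<odot> w (j - 1))"

definition mbar_act :: "complex \<Rightarrow> sl2 \<Rightarrow> mbar \<Rightarrow> mbar"
  where "mbar_act \<nu> = bilin_ext (mbar_basis_act \<nu>)"

lemma lie_module_mbar: "lie_module fscale UNIV sl2_bracket fscale (mbar_act \<nu>)"
proof -
  note simps = mbar_act_def sl2_bracket_def bilin_ext_simps bilin_ext_uminus fs.scale_right_distrib
  let ?R = "mbar_act \<nu>"
  have 0: "?R (sl2_bracket (bvec a) (bvec b)) (w j) = ?R (bvec a) (?R (bvec b) (w j)) - ?R (bvec b) (?R (bvec a) (w j))" for a b j
    by (rule poly_mapping_eqI, cases j; cases a; cases b)
      (simp_all add: simps lookup_minus, simp_all add: algebra_simps)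
  have 1: "?R (sl2_bracket (bvec a) (bvec b)) v = ?R (bvec a) (?R (bvec b) v) - ?R (bvec b) (?R (bvec a) v)" for a b v
  proof (induction v rule: bvec_induct)
    case (step c j v)
    then show ?case using arg_cong[OF 0[of a b j], of "fscale c"]
      by (simp add: simps fs.scale_right_diff_distrib)
  qed (simp add: simps)
  have 2: "?R (sl2_bracket (bvec a) y) v = ?R (bvec a) (?R y v) - ?R y (?R (bvec a) v)" for a y v
  proof (induction y rule: bvec_induct)
    case (step c b y)
    then show ?case using arg_cong[OF 1[of a b v], of "fscale c"]
      by (simp add: simps fs.scale_right_diff_distrib)
  qed (simp add: simps)
  have 3: "?R (sl2_bracket x y) v = ?R x (?R y v) - ?R y (?R x v)" for x y v
  proof (induction x rule: bvec_induct)
    case (step c b x)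
    then show ?case using arg_cong[OF 2[of b y v], of "fscale c"]
      by (simp add: simps fs.scale_right_diff_distrib)
  qed (simp add: simps)
  show ?thesis
    by (intro lie_module.intro lie_algebra_sl2 vector_space_fscale lie_module_axioms.intro 3)
      (simp_all add: mbar_act_def linear_bilin_ext bilin_ext_simps)
qed

text \<open>The condition \<open>\<rho> \<in> extensional witt_lt\<close> only fixes the irrelevant values of \<open>\<rho>\<close> outside
  \<open>Witt\<^sub><\<close>, so that equality of structures is equality of maps on \<open>Witt\<^sub><\<close>.\<close>

definition compatible_witt_lt_structure ::
    "(sl2 \<Rightarrow> mbar \<Rightarrow> mbar) \<Rightarrow> (witt \<Rightarrow> mbar \<Rightarrow> mbar) \<Rightarrow> bool"
  where "compatible_witt_lt_structure \<sigma> \<rho> \<longleftrightarrow>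
    \<rho> \<in> extensional witt_lt \<and>
    lie_module fscale witt_lt witt_bracket fscale \<rho> \<and>
    (\<forall>x. \<rho> (sl2_embed x) = \<sigma> x)"

text \<open>For \<open>n < 0\<close> the denominator is the product of the \<open>-n\<close> factors \<open>z + n, \<dots>, z - 1\<close>.\<close>

definition int_pochhammer :: "complex \<Rightarrow> int \<Rightarrow> complex"
  where "int_pochhammer z n =
    (if n \<ge> 0 then pochhammer z (nat n) else 1 / pochhammer (z + of_int n) (nat (- n)))"

end

theory Submission
  imports Defs
begin

text \<open>
  Existence. Rescale the basis to \<open>u\<^sub>n = w\<^sub>n / n!\<close> and put \<open>u\<^sub>n = 0\<close> for \<open>n < 0\<close>. The asserted
  formula becomes \<open>L\<^sub>i u\<^sub>n = -(1 + n + (1 - i) \<lambda>/2) u\<^bsub>n+i\<^esub>\<close>, in which one recognises a module of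
  tensor densities over the full Witt algebra: on symbols \<open>u\<^sub>n\<close>, \<open>n \<in> \<int>\<close>, the bracket relation is a
  polynomial identity in \<open>n\<close>, \<open>i\<close>, \<open>k\<close> and \<open>\<lambda>\<close>. The symbols with \<open>n < 0\<close> span a
  subspace stable under all \<open>L\<^sub>i\<close> with \<open>i \<le> 0\<close>, and also under \<open>L\<^sub>1\<close> because the coefficient of \<open>L\<^sub>1 u\<^sub>-\<^sub>1\<close> is \<open>0\<close>. Setting these
  symbols to \<open>0\<close> is therefore passing to a quotient module of \<open>Witt\<^sub><\<close> (\<open>density_act_scaled_w\<close>).

  Uniqueness. Compatibility prescribes \<open>L\<^sub>1\<close> and \<open>L\<^sub>0\<close>. Let \<open>m \<ge> 1\<close>. The vector \<open>L\<^sub>-\<^sub>m w\<^sub>0\<close> has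
  \<open>h\<close>-weight \<open>\<nu> - 2m\<close>, which is not a weight of the module, so it vanishes. As \<open>w\<^sub>0\<close> generates the
  module under \<open>L\<^sub>1\<close> and \<open>[L\<^sub>1, L\<^sub>-\<^sub>m] = (m + 1) L\<^bsub>1-m\<^esub>\<close>, the operator \<open>L\<^sub>-\<^sub>m\<close> is then determined by
  \<open>L\<^bsub>1-m\<^esub>\<close> and \<open>L\<^sub>1\<close>. Induction on \<open>m\<close> shows that two compatible structures coincide, whatever
  the parameter \<open>\<nu>\<close> (\<open>compatible_structures_equal\<close>).
\<close>

section \<open>Linear maps determined on the basis\<close>

lemma L_in_witt_lt: "i \<le> 1 \<Longrightarrow> L i \<in> witt_lt"
  unfolding witt_lt_def by (rule fs.span_base) blast

lemma lookup_bvec: "Poly_Mapping.lookup (bvec b) a = (if a = b then 1 else 0)"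
  by (simp add: bvec_def lookup_single when_def)

lemma linear_eq_on_bvec:
  assumes "Vector_Spaces.linear fscale fscale F" "Vector_Spaces.linear fscale fscale G"
    and "\<And>b. F (bvec b) = G (bvec b)"
  shows "F v = G v"
proof (induction v rule: bvec_induct)
  case zero
  interpret F: Vector_Spaces.linear fscale fscale F by fact
  interpret G: Vector_Spaces.linear fscale fscale G by fact
  show ?case by (simp only: F.zero G.zero)
next
  case (step c b x)
  then show ?case
    using assms by (simp add: Vector_Spaces.linear_iff)
qed

lemma witt_lt_induct [consumes 1, case_names zero step]:
  assumes "x \<in> witt_lt" "P 0"
    and "\<And>c i x. i \<le> 1 \<Longrightarrow> x \<in> witt_lt \<Longrightarrow> P x \<Longrightarrow> P (c \<odot> L i + x)"
  shows "P x"
proof -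
  have "x \<in> witt_lt \<and> P x"
    using assms(1)[unfolded witt_lt_def]
  proof (induction rule: fs.span_induct_alt)
    case base
    then show ?case using assms(2) by (simp add: witt_lt_def fs.span_zero)
  next
    case (step c y x)
    then obtain i where "i \<le> 1" "y = L i" by blast
    moreover have "c \<odot> L i + x \<in> witt_lt"
      using step \<open>i \<le> 1\<close> L_in_witt_lt[of i] unfolding witt_lt_def
      by (intro fs.span_add fs.span_scale) simp_all
    ultimately show ?case
      using step assms(3) by blast
  qed
  then show ?thesis ..
qed

section \<open>The module of densities\<close>

definition density_coeff :: "complex \<Rightarrow> int \<Rightarrow> int \<Rightarrow> complex"
  where "density_coeff lam i n = - (1 + of_int n + (1 - of_int i) * lam / 2)"

text \<open>The vectors \<open>u\<^sub>n\<close>, \<open>n \<in> \<int>\<close>. Allowing negative \<open>n\<close> lets the action be described by one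
  coefficient, polynomial in \<open>n\<close>, without case distinctions at the lower end of the basis.\<close>

definition scaled_w :: "int \<Rightarrow> mbar"
  where "scaled_w n = (if n < 0 then 0 else (1 / fact (nat n)) \<odot> w (nat n))"

definition density_act :: "complex \<Rightarrow> witt \<Rightarrow> mbar \<Rightarrow> mbar"
  where "density_act lam =
    bilin_ext (\<lambda>i j. (fact j * density_coeff lam i (int j)) \<odot> scaled_w (int j + i))"

lemma w_eq_scaled_w: "w j = fact j \<odot> scaled_w (int j)"
  by (simp add: scaled_w_def)

lemmas density_act_simps = bilin_ext_simps[of "\<lambda>i j. (fact j * density_coeff lam i (int j)) \<odot> scaled_w (int j + i)" for lam,
  folded density_act_def]

lemma linear_density_act: "Vector_Spaces.linear fscale fscale (density_act lam x)"
  by (simp add: density_act_def linear_bilin_ext)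

text \<open>For \<open>n < 0\<close> both sides vanish: either \<open>n + i < 0\<close>, or \<open>i = 1\<close> and \<open>n = -1\<close>, where the coefficient
  is \<open>0\<close>. In contrast, \<open>L\<^sub>2\<close> would send the symbol \<open>u\<^sub>-\<^sub>1\<close> to \<open>(\<lambda>/2) u\<^sub>1\<close>, so that
  for \<open>\<lambda> \<noteq> 0\<close> the symbols with negative index do not span a submodule for the full Witt algebra.\<close>

lemma density_act_scaled_w:
  assumes "i \<le> 1"
  shows "density_act lam (L i) (scaled_w n) = density_coeff lam i n \<odot> scaled_w (n + i)"
proof (cases "n < 0")
  case True
  have "density_coeff lam i n = 0 \<or> n + i < 0"
  proof (cases "n + i < 0")
    case False
    with True assms have "i = 1" "n = -1" by auto
    then show ?thesis by (simp add: density_coeff_def)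
  qed simp
  with True show ?thesis
    by (auto simp: scaled_w_def density_act_simps)
next
  case False
  then show ?thesis
    by (simp add: scaled_w_def[of n] density_act_simps)
qed

lemma density_coeff_bracket:
  "density_coeff lam i (n + k) * density_coeff lam k n - density_coeff lam k (n + i) * density_coeff lam i n
    = of_int (i - k) * density_coeff lam (i + k) n"
  by (simp add: density_coeff_def field_simps)

lemma density_act_bracket_basis:
  assumes "i \<le> 1" "k \<le> 1"
  shows "density_act lam (witt_bracket (L i) (L k)) (w j)
    = density_act lam (L i) (density_act lam (L k) (w j)) - density_act lam (L k) (density_act lam (L i) (w j))"
proof -
  let ?A = "density_coeff lam" and ?u = scaled_w and ?R = "density_act lam"
  have "?R (L i) (?R (L k) (?u n)) - ?R (L k) (?R (L i) (?u n))
      = (?A i (n + k) * ?A k n) \<odot> ?u (n + (i + k)) - (?A k (n + i) * ?A i n) \<odot> ?u (n + (i + k))" for n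
    using assms by (simp add: density_act_scaled_w density_act_simps add_ac mult.commute)
  then have "?R (L i) (?R (L k) (?u n)) - ?R (L k) (?R (L i) (?u n))
      = (of_int (i - k) * ?A (i + k) n) \<odot> ?u (n + (i + k))" for n
    by (simp only: fs.scale_left_diff_distrib[symmetric] density_coeff_bracket)
  moreover have "?R (witt_bracket (L i) (L k)) (?u n) = (of_int (i - k) * ?A (i + k) n) \<odot> ?u (n + (i + k))" for n
  proof (cases "i = 1 \<and> k = 1")
    case True
    then show ?thesis by (simp add: witt_bracket_def bilin_ext_simps density_act_simps)
  next
    case False
    with assms have "i + k \<le> 1" by linarith
    then show ?thesis
      by (simp add: witt_bracket_def bilin_ext_simps density_act_simps density_act_scaled_w del: of_int_diff)
  qed
  ultimately have "?R (witt_bracket (L i) (L k)) (?u n) = ?R (L i) (?R (L k) (?u n)) - ?R (L k) (?R (L i) (?u n))" for n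
    by simp
  then show ?thesis
    by (simp add: w_eq_scaled_w density_act_simps fs.scale_right_diff_distrib)
qed

lemma density_act_bracket:
  assumes "x \<in> witt_lt" "y \<in> witt_lt"
  shows "density_act lam (witt_bracket x y) v
    = density_act lam x (density_act lam y v) - density_act lam y (density_act lam x v)"
proof -
  let ?R = "density_act lam"
  note simps = density_act_simps witt_bracket_def bilin_ext_simps fs.scale_right_distrib
  have 1: "?R (witt_bracket (L i) (L k)) v = ?R (L i) (?R (L k) v) - ?R (L k) (?R (L i) v)"
    if "i \<le> 1" "k \<le> 1" for i k v
  proof (induction v rule: bvec_induct)
    case (step c j v)
    then show ?case
      using arg_cong[OF density_act_bracket_basis[OF that, of lam j], of "fscale c"]
      by (simp only: density_act_simps fs.scale_right_diff_distrib) (simp add: algebra_simps)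
  qed (simp add: density_act_simps)
  have 2: "?R (witt_bracket (L i) y) v = ?R (L i) (?R y v) - ?R y (?R (L i) v)" if "i \<le> 1" for i
    using assms(2)
  proof (induction y rule: witt_lt_induct)
    case (step c k y)
    then show ?case
      using arg_cong[OF 1[OF that step(1), of v], of "fscale c"]
      by (simp add: simps fs.scale_right_diff_distrib)
  qed (simp add: simps)
  show ?thesis
    using assms(1)
  proof (induction x rule: witt_lt_induct)
    case (step c i x)
    then show ?case
      using arg_cong[OF 2[OF step(1)], of "fscale c"]
      by (simp add: simps fs.scale_right_diff_distrib)
  qed (simp add: simps)
qed

lemma density_act_L_w:
  "density_act lam (L i) (w j) = (fact j * density_coeff lam i (int j)) \<odot> scaled_w (int j + i)"
  by (rule density_act_simps)

lemma density_act_sl2_embed_basis: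
  "density_act lam (sl2_embed (bvec a)) (w j) = mbar_act (lam + 2) (bvec a) (w j)"
proof -
  have neg: "density_act lam (- y) v = - density_act lam y v" for y v
    by (simp add: density_act_def bilin_ext_uminus)
  have mbar: "mbar_act (lam + 2) (bvec a) (w j) = mbar_basis_act (lam + 2) a j"
    by (simp add: mbar_act_def bilin_ext_simps)
  show ?thesis
  proof (cases a)
    case Sl2_e
    have "- (fact j * density_coeff lam 1 (int j)) = fact (Suc j)"
      by (simp add: density_coeff_def algebra_simps)
    then have "- density_act lam (L 1) (w j) = w (Suc j)"
      by (simp only: density_act_L_w w_eq_scaled_w[of "Suc j"] fs.scale_minus_left[symmetric] of_nat_Suc add.commute)
    with Sl2_e show ?thesis
      unfolding mbar by (simp add: sl2_embed_def neg)
  next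
    case Sl2_h
    have "- (2 * (fact j * density_coeff lam 0 (int j))) = (lam + 2 + 2 * of_nat j) * fact j"
      by (simp add: density_coeff_def algebra_simps)
    then have "- (2 \<odot> density_act lam (L 0) (w j)) = (lam + 2 + 2 * of_nat j) \<odot> w j"
      unfolding density_act_L_w
      by (simp only: w_eq_scaled_w[of j] fs.scale_minus_left[symmetric] fs.scale_scale add_0_right
          mult_minus_left)
    with Sl2_h show ?thesis
      unfolding mbar by (simp add: sl2_embed_def neg density_act_simps(3))
  next
    case Sl2_f
    show ?thesis
    proof (cases j)
      case 0
      then show ?thesis
        using Sl2_f unfolding mbar by (simp add: sl2_embed_def density_act_L_w scaled_w_def)
    next
      case (Suc m)
      have "fact j * density_coeff lam (- 1) (int j) = - of_nat j * (lam + 2 + of_nat j - 1) * fact m"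
        unfolding Suc by (simp add: density_coeff_def algebra_simps)
      moreover have "int j + - 1 = int m"
        using Suc by simp
      ultimately have "density_act lam (L (- 1)) (w j) = (- of_nat j * (lam + 2 + of_nat j - 1)) \<odot> w m"
        by (simp only: density_act_L_w w_eq_scaled_w[of m] fs.scale_scale)
      with Sl2_f Suc show ?thesis
        unfolding mbar by (simp add: sl2_embed_def del: of_nat_Suc)
    qed
  qed
qed

lemma density_act_sl2_embed: "density_act lam (sl2_embed x) v = mbar_act (lam + 2) x v"
proof (induction x rule: bvec_induct)
  case zero
  show ?case
    by (simp add: sl2_embed_def mbar_act_def density_act_simps(5) bilin_ext_simps(5))
next
  case (step c a x)
  have "density_act lam (sl2_embed (bvec a)) v = mbar_act (lam + 2) (bvec a) v"
    by (rule linear_eq_on_bvec[OF linear_density_act _ density_act_sl2_embed_basis])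
      (simp add: mbar_act_def linear_bilin_ext)
  with step show ?case
    by (simp only: sl2_embed_def mbar_act_def density_act_simps bilin_ext_simps lin_ext_add lin_ext_scale)
qed

lemma compatible_density_act:
  "compatible_witt_lt_structure (mbar_act (lam + 2)) (restrict (density_act lam) witt_lt)"
proof -
  interpret W: lie_algebra fscale witt_lt witt_bracket by (rule lie_algebra_witt_lt)
  note closed = W.bracket_closed fs.subspace_add[OF W.subspace_carrier] fs.subspace_scale[OF W.subspace_carrier]
  have "lie_module fscale witt_lt witt_bracket fscale (restrict (density_act lam) witt_lt)"
  proof (intro lie_module.intro lie_algebra_witt_lt vector_space_fscale lie_module_axioms.intro)
    fix x y v assume "x \<in> witt_lt" "y \<in> witt_lt"
    then show "restrict (density_act lam) witt_lt (witt_bracket x y) v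
        = restrict (density_act lam) witt_lt x (restrict (density_act lam) witt_lt y v)
          - restrict (density_act lam) witt_lt y (restrict (density_act lam) witt_lt x v)"
      by (simp only: restrict_apply' closed density_act_bracket)
  qed (simp_all only: restrict_apply' closed density_act_simps linear_density_act)
  moreover have "restrict (density_act lam) witt_lt (sl2_embed x) = mbar_act (lam + 2) x" for x
    by (rule ext) (simp only: restrict_apply' sl2_embed_in_witt_lt density_act_sl2_embed)
  ultimately show ?thesis
    unfolding compatible_witt_lt_structure_def by (intro conjI allI restrict_extensional)
qed

section \<open>Uniqueness\<close>

lemma L_one_eq_sl2_embed: "L 1 = sl2_embed (- 1 \<odot> bvec Sl2_e)"
  unfolding sl2_embed_def lin_ext_scale by simp

lemma L_zero_eq_sl2_embed: "L 0 = sl2_embed ((- 1 / 2) \<odot> bvec Sl2_h)"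
  unfolding sl2_embed_def lin_ext_scale by simp

lemma compatible_L_one:
  assumes "compatible_witt_lt_structure (mbar_act \<nu>) \<rho>"
  shows "\<rho> (L 1) (w j) = - w (Suc j)"
  using assms unfolding compatible_witt_lt_structure_def L_one_eq_sl2_embed
  by (simp add: mbar_act_def bilin_ext_simps bilin_ext_uminus)

lemma lookup_mbar_act_h:
  "Poly_Mapping.lookup (mbar_act \<nu> (bvec Sl2_h) v) n = (\<nu> + 2 * of_nat n) * Poly_Mapping.lookup v n"
proof (induction v rule: bvec_induct)
  case (step c j v)
  then show ?case
    by (simp add: mbar_act_def bilin_ext_simps lookup_add algebra_simps lookup_bvec)
qed (simp add: mbar_act_def bilin_ext_simps)

lemma compatible_L_zero:
  assumes "compatible_witt_lt_structure (mbar_act \<nu>) \<rho>"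
  shows "Poly_Mapping.lookup (\<rho> (L 0) v) n = - (\<nu> / 2 + of_nat n) * Poly_Mapping.lookup v n"
proof -
  have "\<rho> (L 0) v = (- 1 / 2) \<odot> mbar_act \<nu> (bvec Sl2_h) v"
    using assms unfolding compatible_witt_lt_structure_def L_zero_eq_sl2_embed
    by (simp only: mbar_act_def bilin_ext_simps)
  then show ?thesis
    by (simp add: lookup_mbar_act_h field_simps)
qed

text \<open>The vector \<open>L\<^sub>i w\<^sub>0\<close> has \<open>h\<close>-weight \<open>\<nu> + 2 i\<close>, whereas the weights of the module are the
  \<open>\<nu> + 2 n\<close> with \<open>n \<ge> 0\<close>. The proof compares \<open>L\<^sub>0\<close>-eigenvalues, coordinate by coordinate.\<close>

lemma compatible_kills_w_zero:
  assumes C: "compatible_witt_lt_structure (mbar_act \<nu>) \<rho>" and "i < 0"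
  shows "\<rho> (L i) (w 0) = 0"
proof (rule poly_mapping_eqI)
  fix n
  interpret lie_module fscale witt_lt witt_bracket fscale \<rho>
    using C by (simp add: compatible_witt_lt_structure_def)
  interpret Li: Vector_Spaces.linear fscale fscale "\<rho> (L i)"
    using assms by (intro linear_act L_in_witt_lt) simp
  have "\<rho> (L 0) (w 0) = (- \<nu> / 2) \<odot> w 0"
    by (rule poly_mapping_eqI) (simp add: compatible_L_zero[OF C] lookup_bvec)
  moreover have "\<rho> (witt_bracket (L 0) (L i)) (w 0) = of_int (- i) \<odot> \<rho> (L i) (w 0)"
  proof -
    have "witt_bracket (L 0) (L i) = of_int (- i) \<odot> L i"
      by (simp add: witt_bracket_def bilin_ext_simps)
    then show ?thesis
      using \<open>i < 0\<close> by (simp only: act_scale L_in_witt_lt)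
  qed
  ultimately have "of_int (- i) \<odot> \<rho> (L i) (w 0)
      = \<rho> (L 0) (\<rho> (L i) (w 0)) - (- \<nu> / 2) \<odot> \<rho> (L i) (w 0)"
    using act_bracket[of "L 0" "L i" "w 0"] assms by (simp only: L_in_witt_lt Li.scale)
  from arg_cong[OF this, of "\<lambda>v. Poly_Mapping.lookup v n"]
  have "of_int (int n - i) * Poly_Mapping.lookup (\<rho> (L i) (w 0)) n = 0"
    unfolding lookup_minus lookup_fscale compatible_L_zero[OF C] by (auto simp: field_simps)
  moreover have "(of_int (int n - i) :: complex) \<noteq> 0"
    using \<open>i < 0\<close> by (subst of_int_eq_0_iff) linarith
  ultimately show "Poly_Mapping.lookup (\<rho> (L i) (w 0)) n = Poly_Mapping.lookup 0 n"
    by (metis lookup_zero mult_eq_0_iff)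
qed

text \<open>The relation \<open>[L\<^sub>1, L\<^sub>i] = (1 - i) L\<^bsub>1+i\<^esub>\<close> applied to \<open>w\<^sub>j\<close>, read as a recursion in \<open>j\<close> for the
  operator \<open>L\<^sub>i\<close>: this is possible because \<open>L\<^sub>1 w\<^sub>j = -w\<^bsub>j+1\<^esub>\<close>.\<close>

lemma compatible_w_Suc:
  assumes C: "compatible_witt_lt_structure (mbar_act \<nu>) \<rho>" and "i \<le> 0"
  shows "\<rho> (L i) (w (Suc j)) = of_int (1 - i) \<odot> \<rho> (L (1 + i)) (w j) - \<rho> (L 1) (\<rho> (L i) (w j))"
proof -
  interpret lie_module fscale witt_lt witt_bracket fscale \<rho>
    using C by (simp add: compatible_witt_lt_structure_def)
  interpret Li: Vector_Spaces.linear fscale fscale "\<rho> (L i)"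
    using assms by (intro linear_act L_in_witt_lt) simp
  have "\<rho> (witt_bracket (L 1) (L i)) (w j) = of_int (1 - i) \<odot> \<rho> (L (1 + i)) (w j)"
    using assms by (simp add: witt_bracket_def bilin_ext_simps act_scale L_in_witt_lt del: of_int_diff)
  moreover have "\<rho> (witt_bracket (L 1) (L i)) (w j) = \<rho> (L 1) (\<rho> (L i) (w j)) + \<rho> (L i) (w (Suc j))"
    using act_bracket[of "L 1" "L i" "w j"] assms
    by (simp add: L_in_witt_lt compatible_L_one[OF C] Li.neg)
  ultimately show ?thesis by (simp add: algebra_simps)
qed

lemma compatible_structures_agree_on_L:
  assumes C: "compatible_witt_lt_structure (mbar_act \<nu>) \<rho>" "compatible_witt_lt_structure (mbar_act \<nu>) \<rho>'"
    and "i \<le> 1"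
  shows "\<rho> (L i) v = \<rho>' (L i) v"
proof -
  interpret R: lie_module fscale witt_lt witt_bracket fscale \<rho>
    using C by (simp add: compatible_witt_lt_structure_def)
  interpret R': lie_module fscale witt_lt witt_bracket fscale \<rho>'
    using C by (simp add: compatible_witt_lt_structure_def)
  have one: "\<rho> (L 1) v = \<rho>' (L 1) v" for v
    using C unfolding compatible_witt_lt_structure_def L_one_eq_sl2_embed by metis
  have "\<rho> (L (- int m)) v = \<rho>' (L (- int m)) v" for m v
  proof (induction m arbitrary: v)
    case 0
    then show ?case
      by (intro poly_mapping_eqI) (simp add: compatible_L_zero[OF C(1)] compatible_L_zero[OF C(2)])
  next
    case (Suc m)
    let ?i = "- int (Suc m)"
    \<comment> \<open>\<open>L\<^sub>-\<^sub>m\<close> is known on all vectors; the inner induction treats the next operator one basis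
      vector at a time.\<close>
    have succ: "1 + ?i = - int m" and nonpos: "?i \<le> 0" by simp_all
    note previous = Suc.IH
    have "\<rho> (L ?i) (w j) = \<rho>' (L ?i) (w j)" for j
    proof (induction j)
      case 0
      then show ?case by (simp add: compatible_kills_w_zero[OF C(1)] compatible_kills_w_zero[OF C(2)])
    next
      case (Suc j)
      show ?case
        by (simp only: compatible_w_Suc[OF C(1) nonpos] compatible_w_Suc[OF C(2) nonpos]
            succ previous one Suc.IH)
    qed
    then show ?case
      by (rule linear_eq_on_bvec[OF R.linear_act R'.linear_act, rotated 2]) (simp_all add: L_in_witt_lt)
  qed
  from this[of "nat (- i)"] one \<open>i \<le> 1\<close> show ?thesis
    by (cases "i = 1") simp_all
qed

lemma compatible_structures_equal:
  assumes C: "compatible_witt_lt_structure (mbar_act \<nu>) \<rho>" "compatible_witt_lt_structure (mbar_act \<nu>) \<rho>'"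
  shows "\<rho> = \<rho>'"
proof (rule extensionalityI)
  show "\<rho> \<in> extensional witt_lt" "\<rho>' \<in> extensional witt_lt"
    using C by (simp_all add: compatible_witt_lt_structure_def)
  interpret R: lie_module fscale witt_lt witt_bracket fscale \<rho>
    using C by (simp add: compatible_witt_lt_structure_def)
  interpret R': lie_module fscale witt_lt witt_bracket fscale \<rho>'
    using C by (simp add: compatible_witt_lt_structure_def)
  fix x assume "x \<in> witt_lt"
  then have "\<rho> x v = \<rho>' x v" for v
  proof (induction x rule: witt_lt_induct)
    case zero
    show ?case
      using R.act_scale[of "L 0" 0 v] R'.act_scale[of "L 0" 0 v] by (simp add: L_in_witt_lt)
  next
    case (step c i x)
    moreover have "c \<odot> L i \<in> witt_lt"
      using step(1) by (simp add: fs.subspace_scale R.subspace_carrier L_in_witt_lt)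
    ultimately show ?case
      by (simp add: R.act_add R'.act_add R.act_scale R'.act_scale L_in_witt_lt
          compatible_structures_agree_on_L[OF C step(1)])
  qed
  then show "\<rho> x = \<rho>' x" by blast
qed

section \<open>The explicit formula\<close>

text \<open>Both signs of \<open>i\<close> come from \<open>(n + m)! = n! (n + 1) \<cdots> (n + m)\<close>. The quotient of factorials
  is exactly what the scaling \<open>u\<^sub>n = w\<^sub>n / n!\<close> absorbs.\<close>

lemma int_pochhammer_eq_fact_quotient:
  assumes "int j + i \<ge> 0"
  shows "int_pochhammer (of_int (int j + i + 1)) (- i) = fact j / fact (nat (int j + i))"
proof -
  have split: "fact (n + m) = fact n * pochhammer (of_nat n + 1 :: complex) m" for n m
    using pochhammer_product'[of "1 :: complex" n m] by (simp add: pochhammer_fact add.commute)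
  obtain n where n: "int j + i = int n"
    using assms nonneg_int_cases by blast
  show ?thesis
  proof (cases "i \<le> 0")
    case True
    then obtain m where m: "i = - int m"
      using nonpos_int_cases by blast
    with n have "j = n + m" by linarith
    then show ?thesis
      using split[of n m] m by (simp add: int_pochhammer_def add.commute)
  next
    case False
    then obtain m where m: "i = int m"
      by (metis nonneg_int_cases linorder_linear)
    with False n have "n = j + m" "m > 0" by linarith+
    moreover have "of_int (int j + i + 1) + of_int (- i) = (of_nat j + 1 :: complex)"
      by simp
    ultimately have "int_pochhammer (of_int (int j + i + 1)) (- i) = 1 / pochhammer (of_nat j + 1) m"
      unfolding int_pochhammer_def using m by simp
    also have "\<dots> = fact j / fact (j + m)"
      by (simp add: split)
    finally show ?thesis
      by (simp only: n nat_int \<open>n = j + m\<close>)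
  qed
qed

lemma density_act_w:
  "density_act lam (L i) (w j) =
    (if int j + i < 0 then 0
     else (- (1 / 2) * (2 * (1 + of_nat j) + (1 - of_int i) * lam)
             * int_pochhammer (of_int (int j + i + 1)) (- i)) \<odot> w (nat (int j + i)))"
proof (cases "int j + i < 0")
  case False
  then have "int_pochhammer (of_int (int j + i + 1)) (- i) = fact j / fact (nat (int j + i))"
    by (intro int_pochhammer_eq_fact_quotient) simp
  with False show ?thesis
    by (simp only: density_act_simps scaled_w_def if_False fs.scale_scale)
      (simp add: density_coeff_def field_simps)
qed (simp add: density_act_simps scaled_w_def)

theorem theorem4p16:
  fixes lam :: complex
  shows "(\<exists>!\<rho>. compatible_witt_lt_structure (mbar_act (lam + 2)) \<rho>) \<and>
    (\<forall>\<rho>. compatible_witt_lt_structure (mbar_act (lam + 2)) \<rho> \<longrightarrow>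
      (\<forall>(i::int) (j::nat). i \<le> 1 \<longrightarrow>
        \<rho> (L i) (w j) =
          (if int j + i < 0 then 0
           else (- (1 / 2) * (2 * (1 + of_nat j) + (1 - of_int i) * lam)
                   * int_pochhammer (of_int (int j + i + 1)) (- i))
                \<odot> w (nat (int j + i)))))"
proof (intro conjI allI impI)
  show "\<exists>!\<rho>. compatible_witt_lt_structure (mbar_act (lam + 2)) \<rho>"
    using compatible_density_act compatible_structures_equal by blast
next
  fix \<rho> and i :: int and j :: nat
  assume C: "compatible_witt_lt_structure (mbar_act (lam + 2)) \<rho>" and i: "i \<le> 1"
  have "\<rho> = restrict (density_act lam) witt_lt"
    by (rule compatible_structures_equal[OF C compatible_density_act])
  with i show "\<rho> (L i) (w j) =
      (if int j + i < 0 then 0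
       else (- (1 / 2) * (2 * (1 + of_nat j) + (1 - of_int i) * lam)
               * int_pochhammer (of_int (int j + i + 1)) (- i)) \<odot> w (nat (int j + i)))"
    by (simp only: restrict_apply' L_in_witt_lt density_act_w)
qed

end
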